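(* Let $k,p,n$ be positive integers. For any matrix $A\in\mathbb{R}^{k\times n}$ and any nonempty set $\Lambda$ of $p$-shapes of $n$, the number of vertices of the Shaped Partition Polytope $\mathcal{P}_A^\Lambda$ is $O\big(n^{(k+1)\binom{p}{2}}\big)$, where the constant implied by $O(\cdot)$ depends only on $k$ and $p$ (not on $n$, $A$ or $\Lambda$).
   Context: Write $[n]=\{1,\ldots,n\}$ and let $A^i$ denote the $i$th column of $A$. A $p$-partition of $[n]$ is an ordered tuple $\pi=(\pi_1,\ldots,\pi_p)$ of pairwise disjoint, possibly empty, sets whose union is $[n]$. A $p$-shape of $n$ is a tuple $\lambda=(\lambda_1,\ldots,\lambda_p)$ of nonnegative integers with $\sum_{i=1}^p\lambda_i=n$. The shape of $\pi$ is $|\pi|=(|\pi_1|,\ldots,|\pi_p|)$. The $A$-matrix of $\pi$ is the $k\times p$ matrix $A^\pi=\big[\sum_{i\in\pi_1}A^i,\ldots,\sum_{i\in\pi_p}A^i\big]$, where an empty sum is $0$. For a nonempty set $\Lambda$ of $p$-shapes of $n$, the Shaped Partition Polytope is $\mathcal{P}_A^\Lambda=\mathrm{conv}\{A^\pi:\ \pi \text{ a } p\text{-partition of } [n],\ |\pi|\in\Lambda\}\subset\mathbb{R}^{k\times p}$. *)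

theory Defs
  imports "HOL-Analysis.Analysis" "HOL-Library.Disjoint_Sets"
begin

text \<open>
  The fixed numbers k and p are the cardinalities of the finite index types \<open>'k\<close> and \<open>'p\<close>;
  a p-tuple is a function on \<open>'p\<close>. Since n has to vary while k and p stay fixed, a real
  k-by-n matrix is given by its columns \<open>A i\<close> for \<open>i \<in> {1..n}\<close>; values of \<open>A\<close> at other
  indices are never used.
\<close>

definition is_partition :: "nat \<Rightarrow> ('p::finite \<Rightarrow> nat set) \<Rightarrow> bool" where
  "is_partition n \<pi> \<longleftrightarrow> disjoint_family \<pi> \<and> (\<Union>j. \<pi> j) = {1..n}"

definition is_shape :: "nat \<Rightarrow> ('p::finite \<Rightarrow> nat) \<Rightarrow> bool" where
  "is_shape n s \<longleftrightarrow> (\<Sum>j\<in>UNIV. s j) = n"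

definition shape_of :: "('p::finite \<Rightarrow> nat set) \<Rightarrow> ('p \<Rightarrow> nat)" where
  "shape_of \<pi> = (\<lambda>j. card (\<pi> j))"

definition partition_matrix ::
  "(nat \<Rightarrow> real ^ 'k::finite) \<Rightarrow> ('p::finite \<Rightarrow> nat set) \<Rightarrow> real ^ 'p ^ 'k" where
  "partition_matrix A \<pi> = (\<chi> r j. (\<Sum>i\<in>\<pi> j. A i) $ r)"

definition shaped_partition_polytope ::
  "nat \<Rightarrow> (nat \<Rightarrow> real ^ 'k::finite) \<Rightarrow> ('p::finite \<Rightarrow> nat) set \<Rightarrow> (real ^ 'p ^ 'k) set" where
  "shaped_partition_polytope n A \<Lambda> =
     convex hull {partition_matrix A \<pi> | \<pi>. is_partition n \<pi> \<and> shape_of \<pi> \<in> \<Lambda>}"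

definition vertices :: "'a::real_vector set \<Rightarrow> 'a set" where
  "vertices P = {v. v extreme_point_of P}"

end

theory Submission
  imports Defs "HOL-Combinatorics.Transposition"
begin

text \<open>
  A vertex \<open>v\<close> is the unique maximiser of some linear functional \<open>C\<close> over the points \<open>A\<^sup>\<pi>\<close>.
  Exchanging \<open>i \<in> \<pi> r\<close> with \<open>j \<in> \<pi> s\<close> keeps the shape, so it cannot increase the value
  of \<open>C\<close>: the difference of columns \<open>r\<close> and \<open>s\<close> of \<open>C\<close> takes values at \<open>A i\<close> at least as
  large as at \<open>A j\<close>. In case of a tie the exchange does not move the point, which forces
  \<open>A i = A j\<close>. Among the partitions that represent \<open>v\<close> one can therefore be chosen for which
  ties are always broken by the order of the indices
  (\<open>vertex_lex_separated_partition\<close>). Then, for every pair of blocks, the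
  points \<open>(A i, i)\<close> of \<open>\<real>\<^bsup>k+1\<^esup>\<close> with indices in the two blocks lie on different sides of a
  hyperplane whose normal has positive last coordinate. The traces of these upper
  halfspaces on \<open>{1..n}\<close>, one for each of the \<open>p choose 2\<close> pairs of blocks, determine the
  partition and hence \<open>v\<close> (\<open>vertices_subset_separators\<close>).

  So it suffices that there are \<open>O(n\<^bsup>k+1\<^esup>)\<close> traces. Since the last coordinate of the normal can be
  scaled to 1, an upper halfspace is given by the \<open>k + 1\<close> parameters \<open>d\<close> and \<open>t\<close> of
  \<open>t < i + d \<bullet> A i\<close>, and the traces form a set family of Vapnik-Chervonenkis dimension at
  most \<open>k + 1\<close> (\<open>upper_halfspace_traces_shattered\<close>). General halfspaces of \<open>\<real>\<^bsup>k+1\<^esup>\<close> have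
  dimension \<open>k + 2\<close>, which would cost a factor \<open>n\<close>. The Sauer-Shelah bound, derived from
  Pajor's inequality (\<open>card_le_card_shattered\<close>), then gives the count.
\<close>

section \<open>Set families and shattering\<close>

definition shatters :: "'a set set \<Rightarrow> 'a set \<Rightarrow> bool" where
  "shatters F S \<longleftrightarrow> (\<forall>T\<subseteq>S. \<exists>U\<in>F. U \<inter> S = T)"

text \<open>
  Pajor's form of the Sauer-Shelah lemma. Splitting \<open>F\<close> by membership of a point \<open>x\<close> and deleting
  \<open>x\<close> gives two families \<open>A\<close> and \<open>B'\<close> on the smaller ground set. A set shattered by
  \<open>A \<union> B'\<close> is shattered by \<open>F\<close>; one shattered by \<open>A \<inter> B'\<close> stays shattered by \<open>F\<close> after
  adding \<open>x\<close>, because every trace is available both with and without \<open>x\<close>.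
\<close>
lemma card_le_card_shattered:
  assumes "finite X" "F \<subseteq> Pow X"
  shows "card F \<le> card {S. S \<subseteq> X \<and> shatters F S}"
  using assms
proof (induction X arbitrary: F rule: finite_induct)
  case empty
  show ?case
  proof (cases "F = {}")
    case False
    with empty have "F = {{}}" by (simp add: subset_singleton_iff)
    then have "{S. S \<subseteq> {} \<and> shatters F S} = {{}}" by (auto simp: shatters_def)
    then show ?thesis using \<open>F = {{}}\<close> by simp
  qed simp
next
  case (insert x X)
  define A where "A = {U \<in> F. x \<notin> U}"
  define B where "B = {U \<in> F. x \<in> U}"
  define B' where "B' = (\<lambda>U. U - {x}) ` B"
  have fin: "finite F"
    using insert.prems insert.hyps(1) by (meson finite_Pow_iff finite_insert finite_subset)
  then have finAB: "finite A" "finite B" "finite B'" by (auto simp: A_def B_def B'_def)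
  have "inj_on (\<lambda>U. U - {x}) B" by (auto simp: inj_on_def B_def)
  then have cB: "card B' = card B" by (simp add: B'_def card_image)
  have "F = A \<union> B" "A \<inter> B = {}" by (auto simp: A_def B_def)
  then have "card F = card A + card B'" using finAB cB by (simp add: card_Un_disjoint)
  also have "\<dots> = card (A \<union> B') + card (A \<inter> B')" using finAB by (intro card_Un_Int)
  also have "\<dots> \<le> card {S. S \<subseteq> X \<and> shatters (A \<union> B') S} + card {S. S \<subseteq> X \<and> shatters (A \<inter> B') S}"
  proof -
    have "A \<union> B' \<subseteq> Pow X" using insert.prems by (auto simp: A_def B_def B'_def)
    then have "A \<inter> B' \<subseteq> Pow X" by blast
    with \<open>A \<union> B' \<subseteq> Pow X\<close> show ?thesis by (intro add_mono insert.IH)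
  qed
  also have "card {S. S \<subseteq> X \<and> shatters (A \<inter> B') S}
      = card (insert x ` {S. S \<subseteq> X \<and> shatters (A \<inter> B') S})"
    using insert.hyps(2) by (intro card_image[symmetric]) (auto simp: inj_on_def)
  also have "card {S. S \<subseteq> X \<and> shatters (A \<union> B') S} + \<dots>
      = card ({S. S \<subseteq> X \<and> shatters (A \<union> B') S} \<union> insert x ` {S. S \<subseteq> X \<and> shatters (A \<inter> B') S})"
    using insert.hyps by (intro card_Un_disjoint[symmetric]) auto
  also have "\<dots> \<le> card {S. S \<subseteq> insert x X \<and> shatters F S}"
  proof (rule card_mono)
    show "finite {S. S \<subseteq> insert x X \<and> shatters F S}" using insert.hyps by simp
    have 1: "shatters F S" if S: "S \<subseteq> X" "shatters (A \<union> B') S" for S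
      unfolding shatters_def
    proof (intro allI impI)
      fix T assume "T \<subseteq> S"
      then obtain U where U: "U \<in> A \<union> B'" "U \<inter> S = T" using S(2) by (auto simp: shatters_def)
      have "x \<notin> S" using S(1) insert.hyps(2) by blast
      show "\<exists>U\<in>F. U \<inter> S = T"
      proof (cases "U \<in> A")
        case True
        then show ?thesis using U by (auto simp: A_def)
      next
        case False
        then obtain V where "V \<in> B" "U = V - {x}" using U by (auto simp: B'_def)
        then show ?thesis using U(2) \<open>x \<notin> S\<close> by (intro bexI[of _ V]) (auto simp: B_def)
      qed
    qed
    have 2: "shatters F (insert x S)" if S: "S \<subseteq> X" "shatters (A \<inter> B') S" for S
      unfolding shatters_def
    proof (intro allI impI)
      fix T assume T: "T \<subseteq> insert x S"
      have xS: "x \<notin> S" using S(1) insert.hyps(2) by blast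
      have "T - {x} \<subseteq> S" using T by auto
      then obtain U where U: "U \<in> A \<inter> B'" "U \<inter> S = T - {x}"
        using S(2) unfolding shatters_def by blast
      obtain V where V: "V \<in> B" "U = V - {x}" using U by (auto simp: B'_def)
      show "\<exists>U\<in>F. U \<inter> insert x S = T"
      proof (cases "x \<in> T")
        case True
        have "V \<inter> insert x S = T" using True U(2) V xS by (auto simp: B_def)
        then show ?thesis using V by (auto simp: B_def)
      next
        case False
        have "U \<inter> insert x S = T" using False U V by auto
        then show ?thesis using U by (auto simp: A_def)
      qed
    qed
    show "{S. S \<subseteq> X \<and> shatters (A \<union> B') S} \<union> insert x ` {S. S \<subseteq> X \<and> shatters (A \<inter> B') S}
        \<subseteq> {S. S \<subseteq> insert x X \<and> shatters F S}"
      using 1 2 by auto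
  qed
  finally show ?case .
qed

lemma card_le_of_shattered_card_le:
  fixes F :: "nat set set"
  assumes "n \<ge> 1" "F \<subseteq> Pow {1..n}"
    and small: "\<And>S. S \<subseteq> {1..n} \<Longrightarrow> shatters F S \<Longrightarrow> card S \<le> m"
  shows "card F \<le> (m + 1) * n ^ m"
proof -
  have "card F \<le> card {S. S \<subseteq> {1..n} \<and> shatters F S}"
    using assms(2) by (intro card_le_card_shattered) auto
  also have "\<dots> \<le> card (\<Union>i\<le>m. {S. S \<subseteq> {1..n} \<and> card S = i})"
    using small by (intro card_mono) auto
  also have "\<dots> \<le> (\<Sum>i\<le>m. card {S. S \<subseteq> {1..n} \<and> card S = i})"
    by (intro card_UN_le) auto
  also have "\<dots> = (\<Sum>i\<le>m. n choose i)" by (simp add: n_subsets)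
  also have "\<dots> \<le> (\<Sum>i\<le>m. n ^ m)"
  proof (rule sum_mono)
    fix i assume "i \<in> {..m}"
    then have "n ^ i \<le> n ^ m" using assms(1) by (intro power_increasing) auto
    moreover have "n choose i \<le> n ^ i" by (cases "i \<le> n") (auto simp: binomial_le_pow binomial_eq_0)
    ultimately show "n choose i \<le> n ^ m" by linarith
  qed
  finally show ?thesis by simp
qed

section \<open>Upper halfspaces over indexed points\<close>

text \<open>
  The indices of those points \<open>(a i, i)\<close> that lie above a hyperplane with normal \<open>(d, 1)\<close>.
\<close>
definition upper_halfspace_traces :: "nat \<Rightarrow> (nat \<Rightarrow> 'a::euclidean_space) \<Rightarrow> nat set set" where
  "upper_halfspace_traces n a = {{i \<in> {1..n}. t < real i + d \<bullet> a i} | d t. True}"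

text \<open>
  If \<open>S\<close> had at least \<open>DIM('a) + 2\<close> elements, the points \<open>a i\<close> would satisfy an affine dependence with
  weights \<open>w\<close>, and \<open>\<Sum>i\<in>S. w i * (i + d \<bullet> a i - t)\<close> would equal \<open>\<Sum>i\<in>S. w i * i\<close> for all \<open>d\<close>
  and \<open>t\<close>. After replacing \<open>w\<close> by \<open>- w\<close> if necessary this number is at most \<open>0\<close>. But a
  halfspace that picks out exactly the indices of positive weight makes every term
  nonnegative and at least one positive.
\<close>
lemma upper_halfspace_traces_shattered:
  fixes a :: "nat \<Rightarrow> 'a::euclidean_space"
  assumes S: "S \<subseteq> {1..n}" and sh: "shatters (upper_halfspace_traces n a) S"
  shows "card S \<le> DIM('a) + 1"
proof (rule ccontr)
  assume "\<not> card S \<le> DIM('a) + 1"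
  have finS: "finite S" using S finite_subset by blast
  have cut: "\<exists>d t. \<forall>i\<in>S. i \<in> T \<longleftrightarrow> t < real i + d \<bullet> a i" if "T \<subseteq> S" for T
  proof -
    obtain U where "U \<in> upper_halfspace_traces n a" "U \<inter> S = T"
      using sh \<open>T \<subseteq> S\<close> unfolding shatters_def by blast
    then obtain d t where "{i \<in> {1..n}. t < real i + d \<bullet> a i} \<inter> S = T"
      unfolding upper_halfspace_traces_def by blast
    then show ?thesis using S by blast
  qed
  \<comment> \<open>Coinciding points are cut off in the order of their indices, so the singleton of the smaller
    index is not a trace; hence \<open>S\<close> indexes distinct points.\<close>
  have no_tie: "\<not> i < j" if "i \<in> S" "j \<in> S" "a i = a j" for i j
  proof
    assume "i < j"
    have "{i} \<subseteq> S" using that by simp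
    from cut[OF this] obtain d t where dt: "\<forall>l\<in>S. l \<in> {i} \<longleftrightarrow> t < real l + d \<bullet> a l"
      by blast
    then have "t < real i + d \<bullet> a i" "\<not> t < real j + d \<bullet> a j" using that \<open>i < j\<close> by auto
    then show False using that(3) \<open>i < j\<close> by simp
  qed
  have inj: "inj_on a S"
    by (rule inj_onI) (metis no_tie linorder_neqE_nat)
  have "card (a ` S) \<ge> DIM('a) + 2"
    using inj \<open>\<not> card S \<le> DIM('a) + 1\<close> by (simp add: card_image)
  then have "affine_dependent (a ` S)"
    using finS by (intro affine_dependent_biggerset) auto
  then obtain u v where u: "sum u (a ` S) = 0" "v \<in> a ` S" "u v \<noteq> 0" "(\<Sum>v\<in>a ` S. u v *\<^sub>R v) = 0"
    using affine_dependent_explicit_finite[of "a ` S"] finS by auto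
  have contra: False
    if w0: "sum w S = 0" and wa: "(\<Sum>i\<in>S. w i *\<^sub>R a i) = 0"
      and wi: "(\<Sum>i\<in>S. w i * real i) \<le> 0" and nz: "\<exists>i\<in>S. w i \<noteq> 0" for w :: "nat \<Rightarrow> real"
  proof -
    obtain d t where "\<forall>i\<in>S. i \<in> {i \<in> S. w i > 0} \<longleftrightarrow> t < real i + d \<bullet> a i"
      using cut[of "{i \<in> S. w i > 0}"] by blast
    then have dt: "0 < w i \<longleftrightarrow> t < real i + d \<bullet> a i" if "i \<in> S" for i
      using that by blast
    have nonneg: "0 \<le> w i * (real i + d \<bullet> a i - t)" if "i \<in> S" for i
    proof (cases "w i > 0")
      case True
      then have "t < real i + d \<bullet> a i" using dt[OF that] by blast
      then show ?thesis using True by simp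
    next
      case False
      then have "real i + d \<bullet> a i - t \<le> 0" using dt[OF that] by linarith
      then show ?thesis using False by (intro mult_nonpos_nonpos) auto
    qed
    \<comment> \<open>The weights sum to \<open>0\<close> and do not all vanish, so one of them is positive.\<close>
    obtain i where i: "i \<in> S" "w i > 0"
    proof (rule ccontr)
      assume "\<not> thesis"
      then have "\<forall>i\<in>S. w i \<le> 0" using that by force
      then have "\<forall>i\<in>S. - w i = 0"
        using w0 finS by (subst sum_nonneg_eq_0_iff[symmetric]) (auto simp: sum_negf)
      then show False using nz by auto
    qed
    have "t < real i + d \<bullet> a i" using dt i by blast
    then have "0 < w i * (real i + d \<bullet> a i - t)" using i by simp
    then have "0 < (\<Sum>i\<in>S. w i * (real i + d \<bullet> a i - t))"
      using finS nonneg i(1) by (intro sum_pos2[of _ i]) simp_all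
    also have "\<dots> = (\<Sum>i\<in>S. w i * real i) + d \<bullet> (\<Sum>i\<in>S. w i *\<^sub>R a i) - sum w S * t"
      by (simp add: algebra_simps sum.distrib sum_subtractf inner_sum_right sum_distrib_left)
    finally show False using w0 wa wi by simp
  qed
  define w where "w = u \<circ> a"
  have w: "sum w S = 0" "(\<Sum>i\<in>S. w i *\<^sub>R a i) = 0" "\<exists>i\<in>S. w i \<noteq> 0"
    using u by (auto simp: w_def sum.reindex[OF inj] o_def)
  show False
  proof (cases "(\<Sum>i\<in>S. w i * real i) \<le> 0")
    case True
    then show False using contra w by blast
  next
    case False
    then show False using contra[of "\<lambda>i. - w i"] w by (auto simp: sum_negf)
  qed
qed

lemma card_upper_halfspace_traces:
  fixes a :: "nat \<Rightarrow> 'a::euclidean_space"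
  assumes "n \<ge> 1"
  shows "card (upper_halfspace_traces n a) \<le> (DIM('a) + 2) * n ^ (DIM('a) + 1)"
proof -
  have "upper_halfspace_traces n a \<subseteq> Pow {1..n}" by (auto simp: upper_halfspace_traces_def)
  from card_le_of_shattered_card_le[OF assms this upper_halfspace_traces_shattered]
  show ?thesis by simp
qed

lemma finite_upper_halfspace_traces: "finite (upper_halfspace_traces n a)"
  by (rule finite_subset[of _ "Pow {1..n}"]) (auto simp: upper_halfspace_traces_def)

text \<open>
  A lexicographic comparison of finitely many pairs \<open>(d \<bullet> a i, i)\<close> is the comparison of
  \<open>M * (d \<bullet> a i) + i\<close> for a sufficiently large weight \<open>M\<close>, and any threshold between the values
  on \<open>R\<close> and those on \<open>T\<close> yields the separating halfspace.
\<close>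
lemma upper_halfspace_trace_separates:
  fixes a :: "nat \<Rightarrow> 'a::euclidean_space"
  assumes R: "R \<subseteq> {1..n}" and T: "T \<subseteq> {1..n}"
    and lex: "\<And>i j. i \<in> R \<Longrightarrow> j \<in> T \<Longrightarrow> d \<bullet> a j < d \<bullet> a i \<or> (a i = a j \<and> j < i)"
  obtains U where "U \<in> upper_halfspace_traces n a" "R \<subseteq> U" "T \<inter> U = {}"
proof -
  have fin: "finite R" "finite T" using R T finite_subset by blast+
  have "\<forall>\<^sub>F M in at_top. \<forall>x\<in>R \<times> T. M * (d \<bullet> a (fst x) - d \<bullet> a (snd x)) + real (fst x) - real (snd x) > 0"
  proof (rule eventually_ball_finite)
    show "finite (R \<times> T)" using fin by simp
    show "\<forall>x\<in>R \<times> T. \<forall>\<^sub>F M in at_top. M * (d \<bullet> a (fst x) - d \<bullet> a (snd x)) + real (fst x) - real (snd x) > 0"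
    proof
      fix x assume "x \<in> R \<times> T"
      then consider (gt) "d \<bullet> a (snd x) < d \<bullet> a (fst x)" | (tie) "a (fst x) = a (snd x)" "snd x < fst x"
        using lex[of "fst x" "snd x"] by auto
      then show "\<forall>\<^sub>F M in at_top. M * (d \<bullet> a (fst x) - d \<bullet> a (snd x)) + real (fst x) - real (snd x) > 0"
      proof cases
        case gt
        define g where "g = d \<bullet> a (fst x) - d \<bullet> a (snd x)"
        have g: "g > 0" using gt by (simp add: g_def)
        have "\<forall>\<^sub>F M in at_top. M > real (snd x) / g" by (rule eventually_gt_at_top)
        then show ?thesis
          unfolding g_def[symmetric]
        proof (rule eventually_mono)
          fix M assume "real (snd x) / g < M"
          then have "real (snd x) < M * g" using g by (simp add: divide_less_eq)
          then show "0 < M * g + real (fst x) - real (snd x)" by simp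
        qed
      next
        case tie
        then show ?thesis by simp
      qed
    qed
  qed
  then obtain M where M: "\<forall>x\<in>R \<times> T. M * (d \<bullet> a (fst x) - d \<bullet> a (snd x)) + real (fst x) - real (snd x) > 0"
    using eventually_happens'[OF trivial_limit_at_top_linorder] by blast
  define h where "h i = real i + (M *\<^sub>R d) \<bullet> a i" for i
  have h: "h j < h i" if "i \<in> R" "j \<in> T" for i j
    using M that by (force simp: h_def algebra_simps)
  obtain t where t: "\<forall>i\<in>R. t < h i" "\<forall>j\<in>T. h j \<le> t"
  proof (cases "T = {}")
    case True
    show ?thesis
    proof (rule that)
      show "\<forall>i\<in>R. Min (insert 0 (h ` R)) - 1 < h i"
      proof
        fix i assume "i \<in> R"
        then have "Min (insert 0 (h ` R)) \<le> h i" using fin by (intro Min_le) auto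
        then show "Min (insert 0 (h ` R)) - 1 < h i" by simp
      qed
    qed (use True in auto)
  next
    case False
    show ?thesis
    proof (rule that)
      show "\<forall>i\<in>R. Max (h ` T) < h i" using fin False h by auto
      show "\<forall>j\<in>T. h j \<le> Max (h ` T)" using fin by auto
    qed
  qed
  let ?U = "{i \<in> {1..n}. t < h i}"
  show ?thesis
  proof (rule that)
    show "?U \<in> upper_halfspace_traces n a"
      unfolding upper_halfspace_traces_def h_def by blast
    show "R \<subseteq> ?U" using t(1) R by blast
    show "T \<inter> ?U = {}" using t(2) by (auto simp: not_less)
  qed
qed

section \<open>Exchanging two elements of a partition\<close>

text \<open>
  Exchanging \<open>i\<close> and \<open>j\<close> is written as taking images under a transposition, a bijection of
  \<open>{1..n}\<close>: this makes it plain that partitions go to partitions of the same shape.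
\<close>
lemma sum_swap_block:
  fixes g :: "nat \<Rightarrow> 'b::ab_group_add"
  assumes \<pi>: "is_partition n \<pi>" and ij: "i \<in> \<pi> r" "j \<in> \<pi> s" "r \<noteq> s"
  shows "sum g (Transposition.transpose i j ` \<pi> q)
    = sum g (\<pi> q) + (if q = r then g j - g i else if q = s then g i - g j else 0)"
proof -
  have disj: "\<pi> x \<inter> \<pi> y = {}" if "x \<noteq> y" for x y
    using \<pi> that by (auto simp: is_partition_def disjoint_family_on_def)
  have "\<pi> q \<subseteq> {1..n}" using \<pi> by (auto simp: is_partition_def)
  then have fin: "finite (\<pi> q)" using finite_subset by blast
  have "sum g (Transposition.transpose i j ` \<pi> q) = (\<Sum>x\<in>\<pi> q. g (Transposition.transpose i j x))"
    by (simp add: sum.reindex)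
  also have "\<dots> = sum g (\<pi> q) + (\<Sum>x\<in>\<pi> q. g (Transposition.transpose i j x) - g x)"
    by (simp add: sum_subtractf)
  also have "(\<Sum>x\<in>\<pi> q. g (Transposition.transpose i j x) - g x)
      = (\<Sum>x\<in>\<pi> q \<inter> {i, j}. g (Transposition.transpose i j x) - g x)"
    using fin by (intro sum.mono_neutral_right) (auto simp: Transposition.transpose_def)
  also have "\<dots> = (if q = r then g j - g i else if q = s then g i - g j else 0)"
  proof -
    have "\<pi> q \<inter> {i, j} = (if q = r then {i} else if q = s then {j} else {})"
      using ij disj[of q r] disj[of q s] disj[of r s] by auto
    then show ?thesis by simp
  qed
  finally show ?thesis .
qed

lemma inner_sum_swap_blocks:
  fixes g :: "nat \<Rightarrow> 'b::real_inner" and \<pi> :: "'p::finite \<Rightarrow> nat set"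
  assumes "is_partition n \<pi>" "i \<in> \<pi> r" "j \<in> \<pi> s" "r \<noteq> s"
  shows "(\<Sum>q\<in>UNIV. c q \<bullet> sum g (Transposition.transpose i j ` \<pi> q))
    = (\<Sum>q\<in>UNIV. c q \<bullet> sum g (\<pi> q)) + (c r - c s) \<bullet> (g j - g i)"
proof -
  have "(\<Sum>q\<in>UNIV. c q \<bullet> sum g (Transposition.transpose i j ` \<pi> q))
    = (\<Sum>q\<in>UNIV. c q \<bullet> sum g (\<pi> q)) + (\<Sum>q\<in>UNIV.
        (if q = r then c r \<bullet> (g j - g i) else 0) + (if q = s then c s \<bullet> (g i - g j) else 0))"
    unfolding sum.distrib[symmetric] sum_swap_block[OF assms]
    using assms(4) by (intro sum.cong) (auto simp: inner_add_right)
  also have "\<dots> = (\<Sum>q\<in>UNIV. c q \<bullet> sum g (\<pi> q)) + (c r - c s) \<bullet> (g j - g i)"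
    by (simp add: sum.distrib inner_diff_left inner_diff_right)
  finally show ?thesis .
qed

lemma is_partition_swap:
  assumes "is_partition n \<pi>" "i \<in> \<pi> r" "j \<in> \<pi> s"
  shows "is_partition n (\<lambda>q. Transposition.transpose i j ` \<pi> q)"
proof -
  have "i \<in> {1..n}" "j \<in> {1..n}" using assms by (auto simp: is_partition_def)
  have "(\<Union>q. Transposition.transpose i j ` \<pi> q) = Transposition.transpose i j ` {1..n}"
    using assms(1) by (simp add: is_partition_def flip: image_UN)
  also have "\<dots> = {1..n}" using \<open>i \<in> {1..n}\<close> \<open>j \<in> {1..n}\<close> by (simp add: transpose_image_eq)
  finally have "(\<Union>q. Transposition.transpose i j ` \<pi> q) = {1..n}" .
  moreover have "disjoint_family (\<lambda>q. Transposition.transpose i j ` \<pi> q)"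
    using assms(1)
    by (simp add: is_partition_def disjoint_family_on_def flip: image_Int[OF inj_transpose])
  ultimately show ?thesis by (simp add: is_partition_def)
qed

lemma shape_of_swap: "shape_of (\<lambda>q. Transposition.transpose i j ` \<pi> q) = shape_of \<pi>"
  by (simp add: shape_of_def card_image)

text \<open>
  A linear functional on matrices, split into its columns, has the form to which
  \<open>inner_sum_swap_blocks\<close> applies.
\<close>
lemma inner_partition_matrix:
  fixes C :: "real ^ 'p::finite ^ 'k::finite"
  shows "C \<bullet> partition_matrix A \<pi> = (\<Sum>q\<in>UNIV. column q C \<bullet> sum A (\<pi> q))"
  unfolding inner_vec_def partition_matrix_def column_def
  by (simp add: sum.swap[of _ "UNIV :: 'k set"])

lemma column_partition_matrix: "column q (partition_matrix A \<pi>) = sum A (\<pi> q)"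
  by (simp add: column_def partition_matrix_def vec_eq_iff)

section \<open>Vertices of the shaped partition polytope\<close>

lemma finite_is_partition: "finite {\<pi> :: 'p::finite \<Rightarrow> nat set. is_partition n \<pi>}"
proof (rule finite_subset)
  show "{\<pi> :: 'p \<Rightarrow> nat set. is_partition n \<pi>} \<subseteq> PiE UNIV (\<lambda>_. Pow {1..n})"
    by (auto simp: is_partition_def)
qed (auto intro: finite_PiE)

text \<open>
  The values of \<open>f\<close> serve as ranks of the blocks. Of all partitions that represent \<open>v\<close>,
  the required one minimises the sum of the \<open>i\<close> weighted by the rank of the block of \<open>i\<close>: were
  \<open>i < j\<close> a tie with \<open>i\<close> in the block of lower rank, the exchange would yield another
  representation of \<open>v\<close> with a smaller weighted sum.
\<close>
lemma vertex_lex_separated_partition: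
  fixes A :: "nat \<Rightarrow> real ^ 'k::finite" and \<Lambda> :: "('p::finite \<Rightarrow> nat) set" and f :: "'p \<Rightarrow> nat"
  assumes "v \<in> vertices (shaped_partition_polytope n A \<Lambda>)"
  obtains \<pi> C where "is_partition n \<pi>" "v = partition_matrix A \<pi>"
    "\<And>r s i j. f r < f s \<Longrightarrow> i \<in> \<pi> r \<Longrightarrow> j \<in> \<pi> s \<Longrightarrow>
       (column r C - column s C) \<bullet> A j < (column r C - column s C) \<bullet> A i \<or> (A i = A j \<and> j < i)"
proof -
  let ?X = "{partition_matrix A \<pi> | \<pi>. is_partition n \<pi> \<and> shape_of \<pi> \<in> \<Lambda>}"
  have finX: "finite ?X"
    by (rule finite_subset[OF _ finite_imageI[OF finite_is_partition[of n], of "partition_matrix A"]]) auto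
  have ext: "v extreme_point_of convex hull ?X"
    using assms by (simp add: vertices_def shaped_partition_polytope_def)
  then have "v \<in> ?X" by (rule extreme_point_of_convex_hull)
  have "{v} face_of convex hull ?X" using ext by (simp add: face_of_singleton)
  then have "{v} exposed_face_of convex hull ?X"
    using finX by (simp add: exposed_face_of_polyhedron polytope_imp_polyhedron polytope_convex_hull)
  then obtain C b where C: "convex hull ?X \<subseteq> {x. C \<bullet> x \<le> b}" "{v} = convex hull ?X \<inter> {x. C \<bullet> x = b}"
    unfolding exposed_face_of_def by blast
  have Cv: "C \<bullet> v = b" using C(2) by blast
  have max: "partition_matrix A \<pi> = v"
    if "is_partition n \<pi>" "shape_of \<pi> \<in> \<Lambda>" "C \<bullet> partition_matrix A \<pi> \<ge> b" for \<pi>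
  proof -
    have "partition_matrix A \<pi> \<in> convex hull ?X" using that by (intro hull_inc) blast
    then have "partition_matrix A \<pi> \<in> convex hull ?X \<inter> {x. C \<bullet> x = b}"
      using C(1) that(3) by force
    then show ?thesis using C(2) by blast
  qed
  define P where "P = {\<pi>. is_partition n \<pi> \<and> shape_of \<pi> \<in> \<Lambda> \<and> partition_matrix A \<pi> = v}"
  \<comment> \<open>Multiplication is written as the inner product of \<open>\<real>\<close>, so that the exchange formula for
    inner products also computes the change of \<open>m\<close>.\<close>
  define m where "m \<pi> = (\<Sum>q\<in>UNIV. real (f q) \<bullet> sum real (\<pi> q))" for \<pi> :: "'p \<Rightarrow> nat set"
  have "finite P" by (rule finite_subset[OF _ finite_is_partition[of n]]) (auto simp: P_def)
  moreover have "P \<noteq> {}" using \<open>v \<in> ?X\<close> by (auto simp: P_def)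
  ultimately obtain \<pi> where \<pi>: "\<pi> \<in> P" and min: "\<And>\<pi>'. \<pi>' \<in> P \<Longrightarrow> m \<pi> \<le> m \<pi>'"
    by (metis arg_min_if_finite(1) arg_min_least)
  have part: "is_partition n \<pi>" and shape: "shape_of \<pi> \<in> \<Lambda>" and v: "partition_matrix A \<pi> = v"
    using \<pi> by (auto simp: P_def)
  have lex: "(column r C - column s C) \<bullet> A j < (column r C - column s C) \<bullet> A i \<or> (A i = A j \<and> j < i)"
    if rs: "f r < f s" and ij: "i \<in> \<pi> r" "j \<in> \<pi> s" for r s i j
  proof (rule disj_imp[THEN iffD2], rule impI)
    assume "\<not> (column r C - column s C) \<bullet> A j < (column r C - column s C) \<bullet> A i"
    then have ge: "(column r C - column s C) \<bullet> (A j - A i) \<ge> 0" by (simp add: inner_diff_right)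
    define \<pi>' where "\<pi>' = (\<lambda>q. Transposition.transpose i j ` \<pi> q)"
    have "r \<noteq> s" using rs by auto
    note swap = part ij \<open>r \<noteq> s\<close>
    have part': "is_partition n \<pi>'" "shape_of \<pi>' \<in> \<Lambda>"
      using is_partition_swap[OF part ij] shape by (auto simp: \<pi>'_def shape_of_swap)
    have "C \<bullet> partition_matrix A \<pi>' \<ge> C \<bullet> partition_matrix A \<pi>"
      using ge unfolding inner_partition_matrix \<pi>'_def inner_sum_swap_blocks[OF swap] by simp
    then have v': "partition_matrix A \<pi>' = v" using max part' v Cv by simp
    \<comment> \<open>Column \<open>r\<close> changes by \<open>A j - A i\<close> although the point stays the same.\<close>
    have "sum A (\<pi>' r) = sum A (\<pi> r)" by (metis v v' column_partition_matrix)
    then have eq: "A i = A j" unfolding \<pi>'_def sum_swap_block[OF swap] by simp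
    have "m \<pi> \<le> m \<pi>'" using v' part' by (intro min) (simp add: P_def)
    then have "(real (f r) - real (f s)) * (real j - real i) \<ge> 0"
      unfolding m_def \<pi>'_def inner_sum_swap_blocks[OF swap] by simp
    then have "j \<le> i" using rs by (auto simp: zero_le_mult_iff)
    moreover have "i \<noteq> j"
      using part ij \<open>r \<noteq> s\<close> by (auto simp: is_partition_def disjoint_family_on_def)
    ultimately show "A i = A j \<and> j < i" using eq by simp
  qed
  show ?thesis using that[OF part v[symmetric] lex] .
qed

text \<open>
  Here \<open>U (r, s)\<close>, for \<open>f r < f s\<close>, is meant to contain block \<open>r\<close> and avoid block \<open>s\<close>.
\<close>
definition partition_of_separators :: "nat \<Rightarrow> ('p \<Rightarrow> nat) \<Rightarrow> ('p \<times> 'p \<Rightarrow> nat set) \<Rightarrow> 'p \<Rightarrow> nat set" where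
  "partition_of_separators n f U r =
     {i \<in> {1..n}. (\<forall>s. f r < f s \<longrightarrow> i \<in> U (r, s)) \<and> (\<forall>q. f q < f r \<longrightarrow> i \<notin> U (q, r))}"

text \<open>
  An index outside block \<open>r\<close> lies in another block \<open>q\<close>, and the set belonging to the pair of
  \<open>q\<close> and \<open>r\<close> excludes it from the reconstructed block \<open>r\<close>.
\<close>
lemma partition_of_separators_eq:
  fixes \<pi> :: "'p::finite \<Rightarrow> nat set"
  assumes "inj f" and \<pi>: "is_partition n \<pi>"
    and U: "\<And>r s. f r < f s \<Longrightarrow> \<pi> r \<subseteq> U (r, s) \<and> \<pi> s \<inter> U (r, s) = {}"
  shows "partition_of_separators n f U = \<pi>"
proof (intro ext set_eqI iffI)
  fix r i assume "i \<in> \<pi> r"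
  moreover have "\<pi> r \<subseteq> {1..n}" using \<pi> by (auto simp: is_partition_def)
  ultimately show "i \<in> partition_of_separators n f U r"
    using U by (fastforce simp: partition_of_separators_def)
next
  fix r i assume i: "i \<in> partition_of_separators n f U r"
  then have "i \<in> (\<Union>q. \<pi> q)" using \<pi> by (simp add: is_partition_def partition_of_separators_def)
  then obtain q where q: "i \<in> \<pi> q" by blast
  consider "f q < f r" | "f r < f q" | "q = r"
    using \<open>inj f\<close> by (metis injD linorder_neqE_nat)
  then show "i \<in> \<pi> r"
    using i q U[of q r] U[of r q] by cases (auto simp: partition_of_separators_def)
qed

lemma card_pairs_less:
  fixes f :: "'p::finite \<Rightarrow> nat"
  assumes "inj f"
  shows "card {(r, s). f r < f s} = CARD('p) choose 2"
proof -
  have "bij_betw (\<lambda>(r, s). {r, s}) {(r, s). f r < f s} {B. B \<subseteq> UNIV \<and> card B = 2}"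
    unfolding bij_betw_def
  proof
    show "inj_on (\<lambda>(r, s). {r, s}) {(r, s). f r < f s}"
      by (auto simp: inj_on_def doubleton_eq_iff)
    show "(\<lambda>(r, s). {r, s}) ` {(r, s). f r < f s} = {B. B \<subseteq> UNIV \<and> card B = 2}"
    proof (intro set_eqI iffI)
      fix B :: "'p set" assume "B \<in> {B. B \<subseteq> UNIV \<and> card B = 2}"
      then obtain x y where xy: "B = {x, y}" "x \<noteq> y" by (auto simp: card_2_iff)
      then consider "f x < f y" | "f y < f x"
        using \<open>inj f\<close> by (metis injD linorder_neqE_nat)
      then show "B \<in> (\<lambda>(r, s). {r, s}) ` {(r, s). f r < f s}"
        using xy by cases (auto simp: image_iff intro: exI[of _ x] exI[of _ y])
    next
      fix B assume "B \<in> (\<lambda>(r, s). {r, s}) ` {(r, s). f r < f s}"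
      then obtain r s where "B = {r, s}" "r \<noteq> s" by auto
      then show "B \<in> {B. B \<subseteq> UNIV \<and> card B = 2}" by simp
    qed
  qed
  then have "card {(r, s). f r < f s} = card {B. B \<subseteq> (UNIV :: 'p set) \<and> card B = 2}"
    by (rule bij_betw_same_card)
  also have "\<dots> = CARD('p) choose 2" by (rule n_subsets) simp
  finally show ?thesis .
qed

lemma vertices_subset_separators:
  fixes A :: "nat \<Rightarrow> real ^ 'k::finite" and \<Lambda> :: "('p::finite \<Rightarrow> nat) set" and f :: "'p \<Rightarrow> nat"
  assumes "inj f"
  shows "vertices (shaped_partition_polytope n A \<Lambda>)
    \<subseteq> (\<lambda>U. partition_matrix A (partition_of_separators n f U)) `
        (PiE {(r, s). f r < f s} (\<lambda>_. upper_halfspace_traces n A))"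
proof
  fix v assume "v \<in> vertices (shaped_partition_polytope n A \<Lambda>)"
  then obtain \<pi> C where \<pi>: "is_partition n \<pi>" "v = partition_matrix A \<pi>"
    and lex: "\<And>r s i j. f r < f s \<Longrightarrow> i \<in> \<pi> r \<Longrightarrow> j \<in> \<pi> s \<Longrightarrow>
       (column r C - column s C) \<bullet> A j < (column r C - column s C) \<bullet> A i \<or> (A i = A j \<and> j < i)"
    by (rule vertex_lex_separated_partition[where f = f]) blast
  have sub: "\<pi> q \<subseteq> {1..n}" for q using \<pi>(1) by (auto simp: is_partition_def)
  have "\<exists>U. U \<in> upper_halfspace_traces n A \<and> \<pi> (fst x) \<subseteq> U \<and> \<pi> (snd x) \<inter> U = {}"
    if "f (fst x) < f (snd x)" for x
    using upper_halfspace_trace_separates[OF sub sub lex[OF that]] by metis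
  then obtain U where U: "\<And>x. f (fst x) < f (snd x) \<Longrightarrow>
      U x \<in> upper_halfspace_traces n A \<and> \<pi> (fst x) \<subseteq> U x \<and> \<pi> (snd x) \<inter> U x = {}"
    by metis
  \<comment> \<open>Restricting to the relevant pairs leaves finitely many families \<open>U'\<close> to count.\<close>
  define U' where "U' = restrict U {(r, s). f r < f s}"
  have "U' \<in> PiE {(r, s). f r < f s} (\<lambda>_. upper_halfspace_traces n A)"
    using U by (auto simp: U'_def)
  moreover have "partition_of_separators n f U' = \<pi>"
    using assms \<pi>(1)
  proof (rule partition_of_separators_eq)
    fix r s assume "f r < f s"
    then show "\<pi> r \<subseteq> U' (r, s) \<and> \<pi> s \<inter> U' (r, s) = {}"
      using U[of "(r, s)"] by (simp add: U'_def)
  qed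
  ultimately show "v \<in> (\<lambda>U. partition_matrix A (partition_of_separators n f U)) `
        (PiE {(r, s). f r < f s} (\<lambda>_. upper_halfspace_traces n A))"
    using \<pi>(2) by blast
qed

theorem theorem4p3:
  shows "\<exists>C::real. \<forall>n\<ge>1. \<forall>(A :: nat \<Rightarrow> real ^ 'k::finite) (\<Lambda> :: ('p::finite \<Rightarrow> nat) set).
    \<Lambda> \<noteq> {} \<and> (\<forall>s\<in>\<Lambda>. is_shape n s) \<longrightarrow>
      finite (vertices (shaped_partition_polytope n A \<Lambda>)) \<and>
      real (card (vertices (shaped_partition_polytope n A \<Lambda>)))
        \<le> C * real n ^ ((CARD('k) + 1) * (CARD('p) choose 2))"
proof -
  obtain f :: "'p \<Rightarrow> nat" where f: "inj f"
    using finite_imp_inj_to_nat_seg[of "UNIV :: 'p set"] by auto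
  show ?thesis
  proof (intro exI[of _ "real ((CARD('k) + 2) ^ (CARD('p) choose 2))"] allI impI)
    fix n :: nat and A :: "nat \<Rightarrow> real ^ 'k" and \<Lambda> :: "('p \<Rightarrow> nat) set"
    assume n: "n \<ge> 1"
    let ?V = "vertices (shaped_partition_polytope n A \<Lambda>)"
    let ?E = "PiE {(r, s). f r < f s} (\<lambda>_. upper_halfspace_traces n A)"
    have finE: "finite ?E" by (simp add: finite_PiE finite_upper_halfspace_traces)
    note sub = vertices_subset_separators[OF f, of n A \<Lambda>]
    have fin: "finite ?V" using finite_subset[OF sub] finE by simp
    have "card ?V \<le> card ?E" using surj_card_le[OF finE sub] .
    also have "\<dots> = card (upper_halfspace_traces n A) ^ (CARD('p) choose 2)"
      by (simp add: card_PiE card_pairs_less[OF f])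
    also have "\<dots> \<le> ((CARD('k) + 2) * n ^ (CARD('k) + 1)) ^ (CARD('p) choose 2)"
      using card_upper_halfspace_traces[OF n, of A] by (intro power_mono) auto
    also have "\<dots> = (CARD('k) + 2) ^ (CARD('p) choose 2) * n ^ ((CARD('k) + 1) * (CARD('p) choose 2))"
      by (simp only: power_mult_distrib power_mult)
    finally have "real (card ?V)
        \<le> real ((CARD('k) + 2) ^ (CARD('p) choose 2) * n ^ ((CARD('k) + 1) * (CARD('p) choose 2)))"
      by (simp only: of_nat_le_iff)
    then show "finite ?V \<and> real (card ?V)
        \<le> real ((CARD('k) + 2) ^ (CARD('p) choose 2)) * real n ^ ((CARD('k) + 1) * (CARD('p) choose 2))"
      using fin by (simp only: of_nat_mult of_nat_power)
  qed
qed

end
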